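(* Let $n \ge 3$ be an integer and let $1 \le r < \lfloor \frac{n}{2} \rfloor$. Then the graph $(C_n^{(r)})^c$ is non-singular if and only if $\gcd(n, 2r+1) = 1$.
   Context: A graph is called non-singular if its adjacency matrix is non-singular. $C_n$ denotes the cycle graph on $n$ vertices. For $1 \le r < \lfloor n/2 \rfloor$, $C_n^{(r)}$ is the graph with the same vertex set as $C_n$ in which two distinct vertices $x,y$ are adjacent exactly when the length of a shortest path from $x$ to $y$ in $C_n$ is at most $r$. The complement $X^c$ of a graph $X$ has the same vertex set, and two distinct vertices are adjacent in $X^c$ exactly when they are not adjacent in $X$ (no loops). *)

theory Defs
  imports
    "Graph_Theory.Pair_Digraph"
    "Graph_Theory.Shortest_Path"
    "Jordan_Normal_Form.Matrix"
begin

text \<open>Finite simple graphs are the instances of \<^locale>\<open>pair_graph\<close>: an edge is represented by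
  its two opposite arcs.\<close>

definition cycle_graph :: "nat \<Rightarrow> nat pair_pre_digraph" where
  "cycle_graph n = \<lparr> pverts = {0..<n},
     parcs = {(x, y). x < n \<and> y < n \<and> (y = Suc x mod n \<or> x = Suc y mod n)} \<rparr>"

text \<open>With unit arc weights \<^const>\<open>wf_digraph.\<mu>\<close> is the length of a shortest path, and
  \<open>\<infinity>\<close> if there is none; see \<open>in_arcs_power_graph\<close> below.\<close>

definition power_graph :: "'a pair_pre_digraph \<Rightarrow> nat \<Rightarrow> 'a pair_pre_digraph" where
  "power_graph G r = \<lparr> pverts = pverts G,
     parcs = {(x, y). x \<in> pverts G \<and> y \<in> pverts G \<and> x \<noteq> y \<and>
       wf_digraph.\<mu> (with_proj G) (\<lambda>_. 1) x y \<le> ereal (real r)} \<rparr>"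

definition complement_graph :: "'a pair_pre_digraph \<Rightarrow> 'a pair_pre_digraph" where
  "complement_graph G = \<lparr> pverts = pverts G,
     parcs = {(x, y). x \<in> pverts G \<and> y \<in> pverts G \<and> x \<noteq> y \<and> (x, y) \<notin> parcs G} \<rparr>"

text \<open>Rows and columns are indexed by the vertices in increasing order. Another order
  would permute rows and columns simultaneously, which does not affect invertibility.\<close>

definition adjacency_matrix :: "'a::linorder pair_pre_digraph \<Rightarrow> real mat" where
  "adjacency_matrix G =
     (let vs = sorted_list_of_set (pverts G)
      in mat (length vs) (length vs) (\<lambda>(i, j). if (vs ! i, vs ! j) \<in> parcs G then 1 else 0))"

definition nonsingular_graph :: "'a::linorder pair_pre_digraph \<Rightarrow> bool" where
  "nonsingular_graph G \<longleftrightarrow> invertible_mat (adjacency_matrix G)"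

lemma pair_graph_cycle_graph:
  assumes "n \<ge> 3"
  shows "pair_graph (cycle_graph n)"
proof -
  have fin: "finite (parcs (cycle_graph n))"
    by (rule finite_subset[of _ "{0..<n} \<times> {0..<n}"]) (auto simp: cycle_graph_def)
  have loop: "Suc x mod n \<noteq> x" if "x < n" for x
    using assms that by (cases "Suc x = n") auto
  show ?thesis
    using loop loop[symmetric] fin
    by unfold_locales (auto simp: cycle_graph_def symmetric_def sym_def)
qed

lemma in_arcs_power_graph:
  assumes "pair_graph G"
  shows "(x, y) \<in> parcs (power_graph G r) \<longleftrightarrow>
    x \<noteq> y \<and> (\<exists>p. pre_digraph.apath (with_proj G) x p y \<and> length p \<le> r)"
proof -
  interpret pair_graph G by fact
  have cost: "awalk_cost (\<lambda>_. 1) p = real (length p)" for p :: "('a \<times> 'a) list"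
    by (induct p) (auto simp: awalk_cost_def)
  show ?thesis
  proof
    assume a: "(x, y) \<in> parcs (power_graph G r)"
    then have xy: "x \<noteq> y" and le: "\<mu> (\<lambda>_. 1) x y \<le> ereal (real r)"
      by (auto simp: power_graph_def)
    then have "\<mu> (\<lambda>_. 1) x y \<noteq> \<infinity>" by auto
    then have "x \<rightarrow>\<^sup>*\<^bsub>with_proj G\<^esub> y" using shortest_path_inf by blast
    then obtain p where "apath x p y" "\<mu> (\<lambda>_. 1) x y = awalk_cost (\<lambda>_. 1) p"
      using min_cost_awalk[of x y "\<lambda>_. 1"] by auto
    then show "x \<noteq> y \<and> (\<exists>p. apath x p y \<and> length p \<le> r)"
      using xy le cost by auto
  next
    assume "x \<noteq> y \<and> (\<exists>p. apath x p y \<and> length p \<le> r)"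
    then obtain p where p: "x \<noteq> y" "awalk x p y" "length p \<le> r"
      by (auto simp: apath_def)
    then have "\<mu> (\<lambda>_. 1) x y \<le> ereal (real r)"
      using min_cost_le_walk_cost[of x p y "\<lambda>_. 1"] cost
      by (metis ereal_less_eq(3) of_nat_le_iff order_trans)
    moreover have "x \<in> pverts G" "y \<in> pverts G"
      using p(2) by (auto dest: awalk_hd_in_verts awalk_last_in_verts)
    ultimately show "(x, y) \<in> parcs (power_graph G r)"
      using p by (simp add: power_graph_def)
  qed
qed

end

theory Submission
  imports Defs "Jordan_Normal_Form.Determinant"
begin

text \<open>The adjacency matrix is \<open>J - B\<close>, with \<open>B\<close> the circulant matrix of the window
  \<open>{-r..r}\<close>. Comparing consecutive rows, a kernel vector, read as an \<open>n\<close>-periodic function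
  on the integers, is also \<open>(2r+1)\<close>-periodic, hence constant if \<open>gcd n (2r+1) = 1\<close>. A constant
  \<open>c\<close> in the kernel satisfies \<open>n c = (2r+1) c\<close>, so \<open>c = 0\<close>. If \<open>d = gcd n (2r+1) > 1\<close>, the
  difference of the indicators of \<open>d\<int>\<close> and \<open>d\<int> + 1\<close> has zero sum over every block of
  length divisible by \<open>d\<close>, so it lies in the kernel.\<close>

section \<open>Invertibility of matrices over a field\<close>

text \<open>Both sides are equivalent to \<open>det A \<noteq> 0\<close>.\<close>

lemma invertible_mat_iff_trivial_kernel:
  fixes A :: "'a::field mat"
  assumes A: "A \<in> carrier_mat n n"
  shows "invertible_mat A \<longleftrightarrow> (\<forall>v \<in> carrier_vec n. A *\<^sub>v v = 0\<^sub>v n \<longrightarrow> v = 0\<^sub>v n)"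
proof -
  have "invertible_mat A \<longleftrightarrow> det A \<noteq> 0"
  proof
    assume "invertible_mat A"
    then obtain B where B: "A * B = 1\<^sub>m n" "B * A = 1\<^sub>m (dim_row B)"
      using A by (auto simp: invertible_mat_def inverts_mat_def)
    \<comment> \<open>\<open>inverts_mat\<close> leaves the shape of \<open>B\<close> open; counting
      columns in the two product equations fixes it.\<close>
    have "dim_col B = n" "dim_row B = n"
      using arg_cong[OF B(1), of dim_col] arg_cong[OF B(2), of dim_col] A by auto
    then have "B \<in> carrier_mat n n" by auto
    from det_mult[OF A this] B(1) show "det A \<noteq> 0" by auto
  next
    assume "det A \<noteq> 0"
    from det_non_zero_imp_unit[OF A this, of "()"]
    obtain B where "B \<in> carrier_mat n n" "A * B = 1\<^sub>m n" "B * A = 1\<^sub>m n"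
      by (auto simp: Units_def ring_mat_def)
    then show "invertible_mat A"
      using A by (auto simp: invertible_mat_def inverts_mat_def)
  qed
  then show ?thesis
    using det_0_iff_vec_prod_zero[OF A] by auto
qed

section \<open>Distances in the cycle as displacements modulo \<open>n\<close>\<close>

lemma arc_cycle_graph_step:
  assumes "n \<ge> 3"
  shows "(nat (k mod int n), nat ((k + 1) mod int n)) \<in> parcs (cycle_graph n)"
    "(nat ((k + 1) mod int n), nat (k mod int n)) \<in> parcs (cycle_graph n)"
proof -
  have "nat ((k + 1) mod int n) = Suc (nat (k mod int n)) mod n"
  proof -
    have "int (Suc (nat (k mod int n)) mod n) = (k + 1) mod int n"
      using assms by (simp add: zmod_int mod_simps add.commute)
    then show ?thesis by (metis nat_int)
  qed
  then show "(nat (k mod int n), nat ((k + 1) mod int n)) \<in> parcs (cycle_graph n)"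
    "(nat ((k + 1) mod int n), nat (k mod int n)) \<in> parcs (cycle_graph n)"
    using assms by (auto simp: cycle_graph_def nat_less_iff)
qed

lemma arc_cycle_graphD:
  assumes "(x, y) \<in> parcs (cycle_graph n)"
  obtains s where "\<bar>s\<bar> \<le> 1" "int y = (int x + s) mod int n"
proof -
  from assms have "x < n" "y < n" "y = Suc x mod n \<or> x = Suc y mod n"
    by (auto simp: cycle_graph_def)
  then consider "int y = (int x + 1) mod int n" | "int y = (int x + (- 1)) mod int n"
  proof cases
    assume "y = Suc x mod n"
    then show ?thesis using that(1) by (simp add: zmod_int add.commute)
  next
    assume "y \<noteq> Suc x mod n"
    then have "x = Suc y mod n" using \<open>y = Suc x mod n \<or> x = Suc y mod n\<close> by simp
    then have "(int x + (- 1)) mod int n = int y mod int n"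
      by (simp add: zmod_int mod_simps)
    then show ?thesis using that(2) \<open>y < n\<close> by simp
  qed
  then show ?thesis using that[of 1] that[of "- 1"] by cases auto
qed

text \<open>Each arc of the cycle moves by 1 or -1 modulo \<open>n\<close>, so a walk of length
  \<open>l\<close> has a displacement of size at most \<open>l\<close>. Conversely, a displacement
  \<open>s\<close> is realised by \<open>\<bar>s\<bar>\<close> steps in one direction. This turns
  shortest paths into arithmetic.\<close>

lemma arcs_power_cycle_graph:
  assumes n: "n \<ge> 3" and xy: "x < n" "y < n"
  shows "(x, y) \<in> parcs (power_graph (cycle_graph n) r) \<longleftrightarrow>
    x \<noteq> y \<and> (\<exists>s. \<bar>s\<bar> \<le> int r \<and> int y = (int x + s) mod int n)"
proof -
  interpret pair_graph "cycle_graph n" using n by (rule pair_graph_cycle_graph)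
  have verts: "pverts (cycle_graph n) = {0..<n}" by (simp add: cycle_graph_def)
  have displacement: "\<exists>s. \<bar>s\<bar> \<le> int (length p) \<and> int v = (int u + s) mod int n"
    if "awalk u p v" for u p v
    using that
  proof (induction p arbitrary: u)
    case Nil
    then show ?case by (intro exI[of _ 0]) (auto simp: awalk_Nil_iff verts)
  next
    case (Cons e p)
    obtain w where e: "e = (u, w)" "(u, w) \<in> parcs (cycle_graph n)" "awalk w p v"
      using Cons.prems by (cases e) (auto simp: awalk_Cons_iff)
    obtain s where s: "\<bar>s\<bar> \<le> 1" "int w = (int u + s) mod int n"
      using arc_cycle_graphD[OF e(2)] .
    obtain t where t: "\<bar>t\<bar> \<le> int (length p)" "int v = (int w + t) mod int n"
      using Cons.IH[OF e(3)] by blast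
    have "int v = (int u + (s + t)) mod int n"
      using s(2) t(2) by (simp add: mod_simps add.assoc)
    moreover have "\<bar>s + t\<bar> \<le> int (length (e # p))" using s(1) t(1) by simp
    ultimately show ?case by blast
  qed
  \<comment> \<open>The start is an arbitrary integer \<open>k\<close>, reduced only when read as a
    vertex, so the induction can pass to \<open>k + 1\<close> without a wrap-around case.\<close>
  have fwd: "\<exists>p. awalk (nat (k mod int n)) p (nat ((k + int t) mod int n)) \<and> length p = t" for k t
  proof (induction t arbitrary: k)
    case 0
    show ?case using n by (intro exI[of _ "[]"]) (auto simp: awalk_Nil_iff verts nat_less_iff)
  next
    case (Suc t)
    obtain p where p: "awalk (nat ((k + 1) mod int n)) p (nat ((k + 1 + int t) mod int n))"
      "length p = t" using Suc.IH by blast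
    then show ?case using arc_cycle_graph_step(1)[OF n, of k]
      by (intro exI[of _ "(nat (k mod int n), nat ((k + 1) mod int n)) # p"])
        (auto simp: awalk_Cons_iff add.assoc)
  qed
  have bwd: "\<exists>p. awalk (nat (k mod int n)) p (nat ((k - int t) mod int n)) \<and> length p = t" for k t
  proof (induction t arbitrary: k)
    case 0
    show ?case using n by (intro exI[of _ "[]"]) (auto simp: awalk_Nil_iff verts nat_less_iff)
  next
    case (Suc t)
    obtain p where p: "awalk (nat ((k - 1) mod int n)) p (nat ((k - 1 - int t) mod int n))"
      "length p = t" using Suc.IH by blast
    then show ?case using arc_cycle_graph_step(2)[OF n, of "k - 1"]
      by (intro exI[of _ "(nat (k mod int n), nat ((k - 1) mod int n)) # p"])
        (auto simp: awalk_Cons_iff algebra_simps)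
  qed
  have cost: "awalk_cost (\<lambda>_. 1) p = real (length p)" for p :: "(nat \<times> nat) list"
    by (induct p) (auto simp: awalk_cost_def)
  show ?thesis
  proof
    assume "(x, y) \<in> parcs (power_graph (cycle_graph n) r)"
    then obtain p where "x \<noteq> y" "awalk x p y" "length p \<le> r"
      using in_arcs_power_graph[OF pair_graph_axioms] by (auto simp: apath_def)
    then show "x \<noteq> y \<and> (\<exists>s. \<bar>s\<bar> \<le> int r \<and> int y = (int x + s) mod int n)"
      using displacement[of x p y] by force
  next
    assume "x \<noteq> y \<and> (\<exists>s. \<bar>s\<bar> \<le> int r \<and> int y = (int x + s) mod int n)"
    then obtain s where s: "x \<noteq> y" "\<bar>s\<bar> \<le> int r" "int y = (int x + s) mod int n" by blast
    have y: "y = nat ((int x + s) mod int n)" using s(3) by (metis nat_int)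
    have "\<exists>p. awalk x p y \<and> length p = nat \<bar>s\<bar>"
      using fwd[of "int x" "nat s"] bwd[of "int x" "nat (- s)"] xy y by (cases "s \<ge> 0") auto
    then obtain p where "awalk x p y" "length p \<le> r" using s(2) by auto
    \<comment> \<open>\<open>\<mu>\<close> is an infimum over all walks, so \<open>p\<close> need
      not be a path.\<close>
    then have "\<mu> (\<lambda>_. 1) x y \<le> ereal (real r)"
      using min_cost_le_walk_cost[of x p y "\<lambda>_. 1"] cost
      by (metis ereal_less_eq(3) of_nat_le_iff order_trans)
    then show "(x, y) \<in> parcs (power_graph (cycle_graph n) r)"
      using xy s(1) by (simp add: power_graph_def verts)
  qed
qed

section \<open>The adjacency matrix as total sum minus window sum\<close>

text \<open>Indices are shifted by \<open>r\<close> so that the window \<open>{i - r..i + r}\<close> is enumerated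
  by \<open>{..<2 * r + 1}\<close>, for which telescoping is available.\<close>

lemma adjacency_matrix_mult_vec:
  assumes n: "n \<ge> 3" and r: "r < n div 2" and v: "v \<in> carrier_vec n" and i: "i < n"
  shows "(adjacency_matrix (complement_graph (power_graph (cycle_graph n) r)) *\<^sub>v v) $ i =
    (\<Sum>j<n. v $ j) - (\<Sum>t<2 * r + 1. v $ nat ((int i - int r + int t) mod int n))"
proof -
  let ?G = "complement_graph (power_graph (cycle_graph n) r)"
  let ?w = "\<lambda>t. nat ((int i - int r + int t) mod int n)"
  let ?W = "?w ` {..<2 * r + 1}"
  have verts: "sorted_list_of_set (pverts ?G) = [0..<n]"
    by (simp add: complement_graph_def power_graph_def cycle_graph_def)
  have arc: "(i, j) \<in> parcs ?G \<longleftrightarrow> j \<notin> ?W" if "j < n" for j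
  proof -
    have "j \<in> ?W \<longleftrightarrow> (\<exists>s. \<bar>s\<bar> \<le> int r \<and> int j = (int i + s) mod int n)"
    proof
      assume "j \<in> ?W"
      then obtain t where "t < 2 * r + 1" "j = ?w t" by blast
      then show "\<exists>s. \<bar>s\<bar> \<le> int r \<and> int j = (int i + s) mod int n"
        using n by (intro exI[of _ "int t - int r"]) (auto simp: algebra_simps)
    next
      assume "\<exists>s. \<bar>s\<bar> \<le> int r \<and> int j = (int i + s) mod int n"
      then obtain s where "\<bar>s\<bar> \<le> int r" "int j = (int i + s) mod int n" by blast
      then have "nat (s + int r) < 2 * r + 1" "j = ?w (nat (s + int r))" by auto
      then show "j \<in> ?W" by blast
    qed
    \<comment> \<open>Displacement 0 puts \<open>i\<close> into its own window, in agreement with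
      the zero diagonal of the complement.\<close>
    moreover have "\<exists>s. \<bar>s\<bar> \<le> int r \<and> int i = (int i + s) mod int n"
      using i by (intro exI[of _ 0]) auto
    ultimately show ?thesis
      using arcs_power_cycle_graph[OF n i that, of r] i that
      by (auto simp: complement_graph_def power_graph_def cycle_graph_def)
  qed
  have W: "?W \<subseteq> {..<n}" using n by (auto simp: nat_less_iff)
  \<comment> \<open>Two indices differ by at most \<open>2 * r < n\<close>, so the window does not
    overlap itself and each of its vertices is counted once.\<close>
  have inj: "inj_on ?w {..<2 * r + 1}"
  proof (rule inj_onI)
    fix s t assume st: "s \<in> {..<2 * r + 1}" "t \<in> {..<2 * r + 1}" "?w s = ?w t"
    then have "(int i - int r + int s) mod int n = (int i - int r + int t) mod int n"
      using n by (simp add: nat_eq_iff)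
    then have "int n dvd int s - int t" by (simp add: mod_eq_dvd_iff)
    moreover have "\<bar>int s - int t\<bar> < int n" using st r by auto
    ultimately show "s = t" using dvd_imp_le_int[of "int s - int t" "int n"] by fastforce
  qed
  have "(adjacency_matrix ?G *\<^sub>v v) $ i = (\<Sum>j<n. (if j \<notin> ?W then 1 else 0) * v $ j)"
    using i v by (simp add: adjacency_matrix_def Let_def verts scalar_prod_def arc lessThan_atLeast0)
  also have "\<dots> = (\<Sum>j\<in>{..<n} - ?W. v $ j)"
    by (rule sum.mono_neutral_cong_right) auto
  also have "\<dots> = (\<Sum>j<n. v $ j) - (\<Sum>j\<in>?W. v $ j)"
    using W by (simp add: sum_diff)
  also have "(\<Sum>j\<in>?W. v $ j) = (\<Sum>t<2 * r + 1. v $ ?w t)"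
    using inj by (simp add: sum.reindex)
  finally show ?thesis .
qed

section \<open>Periodic functions on the integers\<close>

lemma periodic_int_mult:
  fixes f :: "int \<Rightarrow> 'a"
  assumes "\<And>k. f (k + p) = f k"
  shows "f (k + m * p) = f k"
proof (induction m rule: int_induct[of _ 0])
  case (step1 m)
  then show ?case using assms[of "k + m * p"] by (simp add: algebra_simps)
next
  case (step2 m)
  then show ?case using assms[of "k + (m - 1) * p"] by (simp add: algebra_simps)
qed simp

text \<open>By Bezout every integer is a combination of the two periods.\<close>

lemma periodic_int_coprime_constant:
  fixes f :: "int \<Rightarrow> 'a"
  assumes "\<And>k. f (k + p) = f k" "\<And>k. f (k + q) = f k" "coprime p q"
  shows "f k = f 0"
proof -
  obtain a b where "a * p + b * q = 1"
    using bezout_int[of p q] assms(3) by auto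
  then have "k = 0 + (k * a) * p + (k * b) * q"
    by (metis add_0 distrib_left mult.assoc mult.right_neutral)
  then show ?thesis
    using periodic_int_mult[where f = f and p = p, OF assms(1)]
      periodic_int_mult[where f = f and p = q, OF assms(2)] by metis
qed

section \<open>The kernel of the adjacency matrix\<close>

theorem corollary18:
  fixes n r :: nat
  assumes "n \<ge> 3" and "1 \<le> r" and "r < n div 2"
  shows "nonsingular_graph (complement_graph (power_graph (cycle_graph n) r))
    \<longleftrightarrow> gcd n (2 * r + 1) = 1"
proof -
  let ?A = "adjacency_matrix (complement_graph (power_graph (cycle_graph n) r))"
  have A: "?A \<in> carrier_mat n n"
    by (simp add: adjacency_matrix_def Let_def complement_graph_def power_graph_def cycle_graph_def)
  have kernel: "?A *\<^sub>v v = 0\<^sub>v n \<longleftrightarrow>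
      (\<forall>i<n. (\<Sum>t<2 * r + 1. v $ nat ((int i - int r + int t) mod int n)) = (\<Sum>j<n. v $ j))"
    if v: "v \<in> carrier_vec n" for v
    using A adjacency_matrix_mult_vec[OF assms(1,3) v] by (auto simp: vec_eq_iff)
  have "(\<forall>v \<in> carrier_vec n. ?A *\<^sub>v v = 0\<^sub>v n \<longrightarrow> v = 0\<^sub>v n) \<longleftrightarrow> gcd n (2 * r + 1) = 1"
  proof
    assume gcd: "gcd n (2 * r + 1) = 1"
    show "\<forall>v \<in> carrier_vec n. ?A *\<^sub>v v = 0\<^sub>v n \<longrightarrow> v = 0\<^sub>v n"
    proof (intro ballI impI)
      fix v :: "real vec" assume v: "v \<in> carrier_vec n" and Av: "?A *\<^sub>v v = 0\<^sub>v n"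
      define y where "y k = v $ nat (k mod int n)" for k :: int
      have y_n: "y (k + int n) = y k" for k by (simp add: y_def)
      have y_mod: "y (k mod int n + l) = y (k + l)" for k l by (simp add: y_def mod_simps)
      \<comment> \<open>The kernel equations cover only the rows \<open>i < n\<close>; periodicity
        extends them to every integer centre \<open>k\<close>.\<close>
      have win: "(\<Sum>t<2 * r + 1. y (k - int r + int t)) = (\<Sum>j<n. v $ j)" for k
      proof -
        have "y (k mod int n - int r + int t) = y (k - int r + int t)" for t
          using y_mod[of k "int t - int r"] by (simp add: algebra_simps)
        moreover have "nat (k mod int n) < n" using assms(1) by (simp add: nat_less_iff)
        ultimately show ?thesis
          using kernel[OF v] Av assms(1)
          by (auto simp: y_def mod_simps dest!: spec[of _ "nat (k mod int n)"])
      qed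
      have y_r: "y (k + int (2 * r + 1)) = y k" for k
      proof -
        \<comment> \<open>The windows centred at \<open>k + r + 1\<close> and \<open>k + r\<close>
          have equal sums and differ only in the two end terms.\<close>
        have "y (k + int (2 * r + 1)) - y (k + int 0) =
            (\<Sum>t<2 * r + 1. y (k + int (Suc t)) - y (k + int t))"
          by (rule sum_lessThan_telescope[symmetric])
        also have "\<dots> = (\<Sum>t<2 * r + 1. y (k + 1 + int r - int r + int t))
            - (\<Sum>t<2 * r + 1. y (k + int r - int r + int t))"
          by (simp only: sum_subtractf) (simp add: algebra_simps)
        also have "\<dots> = 0" by (simp only: win)
        finally show ?thesis by simp
      qed
      have "coprime (int n) (int (2 * r + 1))"
        using gcd by (metis coprime_int_iff coprime_iff_gcd_eq_1)
      then have const: "y k = y 0" for k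
        using periodic_int_coprime_constant[of y, OF y_n y_r] by blast
      have v_const: "v $ j = y 0" if "j < n" for j
        using const[of "int j"] that by (simp add: y_def)
      have "real (2 * r + 1) * y 0 = real n * y 0"
      proof -
        have "(\<Sum>t<2 * r + 1. y (0 - int r + int t)) = (\<Sum>t<2 * r + 1. y 0)"
          by (intro sum.cong refl const)
        then show ?thesis using win[of 0] v_const by (simp del: sum.lessThan_Suc)
      qed
      \<comment> \<open>This makes the two coefficients of \<open>y 0\<close> different, which
        forces \<open>y 0 = 0\<close>.\<close>
      moreover have "2 * r + 1 < n" using assms(3) by auto
      ultimately have "y 0 = 0" by (metis less_irrefl mult_right_cancel of_nat_eq_iff)
      then show "v = 0\<^sub>v n" using v v_const by (intro eq_vecI) auto
    qed
  next
    assume trivial: "\<forall>v \<in> carrier_vec n. ?A *\<^sub>v v = 0\<^sub>v n \<longrightarrow> v = 0\<^sub>v n"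
    show "gcd n (2 * r + 1) = 1"
    proof (rule ccontr)
      define d where "d = int (gcd n (2 * r + 1))"
      assume "gcd n (2 * r + 1) \<noteq> 1"
      then have d1: "\<not> d dvd 1" by (simp add: d_def)
      have dn: "d dvd int n" and dr: "d dvd int (2 * r + 1)"
        unfolding d_def by (simp_all only: int_dvd_int_iff gcd_dvd1 gcd_dvd2)
      define u :: "int \<Rightarrow> real" where "u k = of_bool (d dvd k)" for k
      \<comment> \<open>Taking a difference of the \<open>d\<close>-periodic \<open>u\<close> makes
        block sums telescope to \<open>u (k - 1 + m) - u (k - 1)\<close>, which vanishes when
        \<open>d\<close> divides \<open>m\<close>.\<close>
      define y where "y k = u k - u (k - 1)" for k
      have u_add: "u (k + l) = u k" if "d dvd l" for k l
        using that by (simp add: u_def dvd_add_left_iff)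
      have y_mod: "y (k mod int n) = y k" for k
      proof -
        have "d dvd k mod int n - m \<longleftrightarrow> d dvd k - m" for m
          using dn by (metis mod_diff_left_eq dvd_mod_iff)
        from this[of 0] this[of 1] show ?thesis by (simp add: y_def u_def)
      qed
      have block: "(\<Sum>t<m. y (k + int t)) = 0" if "d dvd int m" for k m
      proof -
        have "(\<Sum>t<m. y (k + int t)) = (\<Sum>t<m. u (k - 1 + int (Suc t)) - u (k - 1 + int t))"
          by (simp add: y_def algebra_simps)
        also have "\<dots> = u (k - 1 + int m) - u (k - 1 + int 0)"
          by (rule sum_lessThan_telescope)
        finally show ?thesis using u_add[OF that] by simp
      qed
      define v where "v = vec n (\<lambda>j. y (int j))"
      have v: "v \<in> carrier_vec n" by (simp add: v_def)
      have "v $ nat (k mod int n) = y k" for k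
        using assms(1) by (simp add: v_def nat_less_iff y_mod)
      moreover have "(\<Sum>j<n. v $ j) = 0"
        using block[OF dn, of 0] by (simp add: v_def)
      \<comment> \<open>Both the total sum and every window sum are 0, as \<open>d\<close> divides
        \<open>n\<close> and \<open>2 * r + 1\<close>.\<close>
      ultimately have "?A *\<^sub>v v = 0\<^sub>v n"
        unfolding kernel[OF v] using block[OF dr] by (simp del: sum.lessThan_Suc)
      \<comment> \<open>But \<open>v $ 0 = u 0 - u (- 1) = 1\<close>, since \<open>d\<close> does
        not divide 1.\<close>
      then have "v $ 0 = 0" using trivial v assms(1) by auto
      then show False using assms(1) d1 by (simp add: v_def y_def u_def)
    qed
  qed
  then show ?thesis
    unfolding nonsingular_graph_def using invertible_mat_iff_trivial_kernel[OF A] by simp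
qed

end
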